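(* For every $n\ge 7$, the difference graph $\mathcal{D}(A_n)$ of the alternating group $A_n$ on $n$ letters is neither a split graph nor a threshold graph.
   Context: Difference graph: for a finite group $G$, the power graph $\mathcal{P}(G)$ is the simple undirected graph with vertex set $G$ in which distinct $a,b$ are adjacent iff $a\in\langle b\rangle$ or $b\in\langle a\rangle$. The enhanced power graph $\mathcal{P}_E(G)$ is the simple undirected graph with vertex set $G$ in which distinct $a,b$ are adjacent iff $a,b\in\langle c\rangle$ for some $c\in G$. The difference graph $\mathcal{D}(G)$ is obtained from the graph $\mathcal{P}_E(G)-\mathcal{P}(G)$ (vertex set $G$; two vertices are adjacent iff they are adjacent in $\mathcal{P}_E(G)$ but not in $\mathcal{P}(G)$) by removing all isolated vertices. A graph is split if its vertex set is the disjoint union of two subsets, one inducing a complete graph and the other an edgeless graph. A graph is threshold if it has no induced subgraph isomorphic to $C_4$ (cycle on 4 vertices), $P_4$ (path on 4 vertices) or $2K_2$ (disjoint union of two edges). *)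

theory Defs
  imports "HOL-Algebra.Sym_Groups" "Graph_Theory.Graph_Theory"
begin

section \<open>Graphs\<close>

text \<open>A simple undirected graph is a pair digraph whose arc set is symmetric and irreflexive
  (\<^locale>\<open>pair_graph\<close> in the finite case); an edge is represented by its two orientations.\<close>

definition graph_minus :: "'a pair_pre_digraph \<Rightarrow> 'a pair_pre_digraph \<Rightarrow> 'a pair_pre_digraph" where
  "graph_minus H K = \<lparr> pverts = pverts H, parcs = parcs H - parcs K \<rparr>"

definition remove_isolated :: "'a pair_pre_digraph \<Rightarrow> 'a pair_pre_digraph" where
  "remove_isolated H =
     \<lparr> pverts = {v \<in> pverts H. \<exists>w. (v, w) \<in> parcs H \<or> (w, v) \<in> parcs H}, parcs = parcs H \<rparr>"

definition has_induced :: "'a pair_pre_digraph \<Rightarrow> 'b pair_pre_digraph \<Rightarrow> bool" where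
  "has_induced G F \<longleftrightarrow>
     (\<exists>S \<subseteq> pverts G. digraph_iso (with_proj G \<restriction> S) (with_proj F))"

definition C4 :: "nat pair_pre_digraph" where
  "C4 = \<lparr> pverts = {0, 1, 2, 3}, parcs = {(0, 1), (1, 2), (2, 3), (3, 0)}\<^sup>s \<rparr>"

definition P4 :: "nat pair_pre_digraph" where
  "P4 = \<lparr> pverts = {0, 1, 2, 3}, parcs = {(0, 1), (1, 2), (2, 3)}\<^sup>s \<rparr>"

definition two_K2 :: "nat pair_pre_digraph" where
  "two_K2 = \<lparr> pverts = {0, 1, 2, 3}, parcs = {(0, 1), (2, 3)}\<^sup>s \<rparr>"

definition threshold_graph :: "'a pair_pre_digraph \<Rightarrow> bool" where
  "threshold_graph G \<longleftrightarrow> \<not> has_induced G C4 \<and> \<not> has_induced G P4 \<and> \<not> has_induced G two_K2"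

text \<open>Either part of the partition is allowed to be empty.\<close>

definition split_graph :: "'a pair_pre_digraph \<Rightarrow> bool" where
  "split_graph G \<longleftrightarrow>
     (\<exists>A B. A \<union> B = pverts G \<and> A \<inter> B = {} \<and>
        K\<^bsub>card A\<^esub> (with_proj G \<restriction> A) \<and> arcs (with_proj G \<restriction> B) = {})"


section \<open>Graphs of a group\<close>

definition power_graph :: "('a, 'b) monoid_scheme \<Rightarrow> 'a pair_pre_digraph" where
  "power_graph G = \<lparr> pverts = carrier G,
     parcs = {(a, b). a \<in> carrier G \<and> b \<in> carrier G \<and> a \<noteq> b \<and>
       (a \<in> generate G {b} \<or> b \<in> generate G {a})} \<rparr>"

definition enhanced_power_graph :: "('a, 'b) monoid_scheme \<Rightarrow> 'a pair_pre_digraph" where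
  "enhanced_power_graph G = \<lparr> pverts = carrier G,
     parcs = {(a, b). a \<in> carrier G \<and> b \<in> carrier G \<and> a \<noteq> b \<and>
       (\<exists>c \<in> carrier G. a \<in> generate G {c} \<and> b \<in> generate G {c})} \<rparr>"

definition difference_graph :: "('a, 'b) monoid_scheme \<Rightarrow> 'a pair_pre_digraph" where
  "difference_graph G = remove_isolated (graph_minus (enhanced_power_graph G) (power_graph G))"

text \<open>All these are finite simple graphs, so the finiteness and simplicity conditions contained in
  the library predicate for complete graphs add nothing to \<^const>\<open>split_graph\<close>.\<close>

lemma pair_graph_difference_graph:
  assumes "finite (carrier G)"
  shows "pair_graph (difference_graph G)"
proof -
  have "finite (carrier G \<times> carrier G)" using assms by simp
  then have "finite (parcs (difference_graph G))"
    by (rule rev_finite_subset)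
      (auto simp: difference_graph_def remove_isolated_def graph_minus_def
        enhanced_power_graph_def power_graph_def)
  then show ?thesis
    using assms
    by unfold_locales
      (auto simp: difference_graph_def remove_isolated_def graph_minus_def
        enhanced_power_graph_def power_graph_def symmetric_def intro!: symI)
qed

lemma pair_graph_C4: "pair_graph C4"
  by unfold_locales (auto simp: C4_def symcl_def symmetric_def intro!: symI)

lemma pair_graph_P4: "pair_graph P4"
  by unfold_locales (auto simp: P4_def symcl_def symmetric_def intro!: symI)

lemma pair_graph_two_K2: "pair_graph two_K2"
  by unfold_locales (auto simp: two_K2_def symcl_def symmetric_def intro!: symI)

end

theory Submission
  imports Defs
begin

text \<open>The involution \<open>(l m)(r s)\<close> and the 3-cycle \<open>(i j k)\<close> on disjoint supports are powers of their
  product but not of each other, so they are adjacent in the difference graph, whereas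
  non-commuting elements never are. Taking
  \<open>(1 2 3)\<close>, \<open>(4 5)(6 7)\<close> and \<open>(1 2 4)\<close>, \<open>(3 5)(6 7)\<close>, no element of the first pair commutes
  with one of the second, so these four elements induce a \<open>2K\<^sub>2\<close>, which occurs neither in
  threshold nor in split graphs.\<close>

text \<open>The pattern of arcs and non-arcs, with symmetry and the absence of loops, already forces
  the four vertices to be distinct.\<close>

lemma has_induced_two_K2I:
  assumes "pair_graph G"
    and ab: "(a, b) \<in> parcs G" and cd: "(c, d) \<in> parcs G"
    and non: "(a, c) \<notin> parcs G" "(a, d) \<notin> parcs G" "(b, c) \<notin> parcs G" "(b, d) \<notin> parcs G"
  shows "has_induced G two_K2"
proof -
  interpret pair_graph G by fact
  have sym: "(y, x) \<in> parcs G" if "(x, y) \<in> parcs G" for x y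
    using that by (rule arcs_symmetric)
  have noloop: "(x, x) \<notin> parcs G" for x
    using no_loops[of "(x, x)"] by auto
  have verts: "a \<in> pverts G" "b \<in> pverts G" "c \<in> pverts G" "d \<in> pverts G"
    using in_arcsD1[OF ab] in_arcsD2[OF ab] in_arcsD1[OF cd] in_arcsD2[OF cd] by auto
  have dist: "a \<noteq> b" "a \<noteq> c" "a \<noteq> d" "b \<noteq> c" "b \<noteq> d" "c \<noteq> d"
    using ab cd non noloop sym by blast+
  define S where "S = {a, b, c, d}"
  \<comment> \<open>The default 3 is the label of \<open>d\<close>; points outside \<open>S\<close>
    also get it, so injectivity is claimed on \<open>S\<close> only.\<close>
  define f :: "'a \<Rightarrow> nat" where
    "f x = (if x = a then 0 else if x = b then 1 else if x = c then 2 else 3)" for x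
  have f: "f a = 0" "f b = 1" "f c = 2" "f d = 3"
    using dist by (auto simp: f_def)
  define hom where
    "hom = \<lparr> iso_verts = f, iso_arcs = map_prod f f, iso_head = snd, iso_tail = fst \<rparr>"
  have arcs: "{e \<in> parcs G. fst e \<in> S \<and> snd e \<in> S} = {(a, b), (b, a), (c, d), (d, c)}"
  proof -
    \<comment> \<open>As an intersection with \<open>S \<times> S\<close>, the set can be computed
      by deciding each of the sixteen pairs.\<close>
    have "{e \<in> parcs G. fst e \<in> S \<and> snd e \<in> S} = parcs G \<inter> S \<times> S"
      by auto
    moreover have "(b, a) \<in> parcs G" "(d, c) \<in> parcs G"
      using ab cd sym by blast+
    moreover have "(c, a) \<notin> parcs G" "(d, a) \<notin> parcs G" "(c, b) \<notin> parcs G" "(d, b) \<notin> parcs G"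
      using non sym by blast+
    ultimately show ?thesis
      using ab cd non noloop by (simp add: S_def insert_Times_insert Sigma_empty1)
  qed
  have "inj_on f S"
    using f by (auto simp: S_def inj_on_def)
  moreover have "inj_on (map_prod f f) {(a, b), (b, a), (c, d), (d, c)}"
    using f by (auto simp: inj_on_def)
  moreover have "wf_digraph (with_proj G \<restriction> S)"
    by (rule wellformed_induce_subgraph)
  ultimately have "pre_digraph.digraph_isomorphism (with_proj G \<restriction> S) hom"
    by (auto simp: pre_digraph.digraph_isomorphism_def hom_def arcs)
  moreover have "with_proj two_K2 = app_iso hom (with_proj G \<restriction> S)"
  proof -
    have "f ` S = pverts two_K2"
      by (simp add: S_def f two_K2_def)
    moreover have "map_prod f f ` {(a, b), (b, a), (c, d), (d, c)} = parcs two_K2"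
      by (simp add: f two_K2_def symcl_def insert_commute)
    ultimately show ?thesis
      by (simp add: app_iso_def hom_def arcs with_proj_def)
  qed
  ultimately have "digraph_iso (with_proj G \<restriction> S) (with_proj two_K2)"
    unfolding digraph_iso_def by (intro exI[of _ hom] conjI)
  moreover have "S \<subseteq> pverts G"
    using verts by (simp add: S_def)
  ultimately show ?thesis
    unfolding has_induced_def by (intro exI[of _ S] conjI)
qed

text \<open>The edgeless part cannot contain both ends of an edge, so each of the two edges has an
  end in the clique; these two ends would be adjacent, against \<open>non\<close>.\<close>

lemma not_split_graphI:
  assumes "pair_graph G"
    and ab: "(a, b) \<in> parcs G" and cd: "(c, d) \<in> parcs G"
    and non: "(a, c) \<notin> parcs G" "(a, d) \<notin> parcs G" "(b, c) \<notin> parcs G" "(b, d) \<notin> parcs G"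
  shows "\<not> split_graph G"
proof
  interpret pair_graph G by fact
  assume "split_graph G"
  then obtain A B where AB: "A \<union> B = pverts G"
    and A: "K\<^bsub>card A\<^esub> (with_proj G \<restriction> A)" and B: "arcs (with_proj G \<restriction> B) = {}"
    unfolding split_graph_def by blast
  have clique: "(x, y) \<in> parcs G" if "x \<in> A" "y \<in> A" "x \<noteq> y" for x y
  proof -
    have "(x, y) \<in> arcs_ends (with_proj G \<restriction> A)"
      using A that by (auto simp: complete_digraph_def)
    then show ?thesis by (auto simp: arcs_ends_conv)
  qed
  have cover: "x \<in> A \<or> y \<in> A" if "(x, y) \<in> parcs G" for x y
    using in_arcsD1[OF that] in_arcsD2[OF that] AB B that by auto
  have "a \<noteq> c" "a \<noteq> d" "b \<noteq> c" "b \<noteq> d"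
    using ab cd non arcs_symmetric by blast+
  then show False
    using cover[OF ab] cover[OF cd] clique non by blast
qed

lemma (in group) generate_singleton_commute:
  assumes "c \<in> carrier G" "x \<in> generate G {c}" "y \<in> generate G {c}"
  shows "x \<otimes> y = y \<otimes> x"
  using assms by (auto simp: generate_pow int_pow_mult[symmetric] add.commute)

text \<open>Adjacent elements lie in a common cyclic subgroup, which is abelian. The contrapositive
  supplies the non-arcs.\<close>

lemma (in group) difference_graph_arc_commute:
  assumes "(x, y) \<in> parcs (difference_graph G)"
  shows "x \<otimes> y = y \<otimes> x"
  using assms generate_singleton_commute
  by (auto simp: difference_graph_def remove_isolated_def graph_minus_def
      enhanced_power_graph_def)

text \<open>The stabilizer of a point is a subgroup. Hence a permutation that moves a point fixed by
  \<open>q\<close> is not a power of \<open>q\<close>.\<close>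

lemma alt_group_generate_fixes:
  assumes "p \<in> generate (alt_group n) {q}" "q \<in> carrier (alt_group n)" "q x = x"
  shows "p x = x"
  using assms(1)
proof induction
  case one
  then show ?case by (simp add: alt_group_one)
next
  case (incl h)
  then show ?case using assms by simp
next
  case (inv h)
  then have "inj h" "h x = x"
    using assms by (auto simp: alt_group_carrier permutes_inj)
  then show ?case
    using inv assms by (simp add: alt_group_inv_equality inv_f_eq)
next
  case (eng h1 h2)
  then show ?case by (simp add: alt_group_mult)
qed

text \<open>This is \<open>cycle_of_list [i, j, k]\<close> unfolded, the cycle sending
  \<open>i\<close> to \<open>j\<close>, \<open>j\<close> to \<open>k\<close> and \<open>k\<close> to
  \<open>i\<close>, so facts about cycles simplify to this form.\<close>

abbreviation cycle3 :: "'a \<Rightarrow> 'a \<Rightarrow> 'a \<Rightarrow> 'a \<Rightarrow> 'a" where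
  "cycle3 i j k \<equiv> transpose i j \<circ> transpose j k"

abbreviation transpose2 :: "'a \<Rightarrow> 'a \<Rightarrow> 'a \<Rightarrow> 'a \<Rightarrow> 'a \<Rightarrow> 'a" where
  "transpose2 l m r s \<equiv> transpose l m \<circ> transpose r s"

lemma cycle3_cubed:
  assumes "distinct [i, j, k]"
  shows "cycle3 i j k (cycle3 i j k (cycle3 i j k x)) = x"
proof -
  have "cycle3 i j k \<circ> (cycle3 i j k \<circ> cycle3 i j k) = id"
    using cycle_is_id_root[OF assms] by (simp add: numeral_3_eq_3)
  then show ?thesis by (simp add: fun_eq_iff)
qed

lemma transpose_disjoint_commute:
  assumes "distinct [l, m, r, s]"
  shows "transpose l m (transpose r s x) = transpose r s (transpose l m x)"
  using assms cycles_commute[of "[l, m]" "[r, s]"] by (simp add: fun_eq_iff)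

lemma transpose2_involutory:
  assumes "distinct [l, m, r, s]"
  shows "transpose2 l m r s (transpose2 l m r s x) = x"
  by (simp add: transpose_disjoint_commute[OF assms])

lemma cycle3_transpose2_commute:
  assumes "distinct [i, j, k]" "distinct [l, m, r, s]" "{i, j, k} \<inter> {l, m, r, s} = {}"
  shows "cycle3 i j k (transpose2 l m r s x) = transpose2 l m r s (cycle3 i j k x)"
proof -
  \<comment> \<open>\<open>cycles_commute\<close> treats two disjoint cycles, so the 3-cycle is
    moved past one transposition at a time.\<close>
  have "cycle3 i j k (transpose u v y) = transpose u v (cycle3 i j k y)"
    if "u \<noteq> v" "{u, v} \<subseteq> {l, m, r, s}" for u v y
  proof -
    have "{i, j, k} \<inter> {u, v} = {}" using that(2) assms(3) by blast
    then show ?thesis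
      using cycles_commute[of "[i, j, k]" "[u, v]"] assms(1) that(1)
      by (simp add: fun_eq_iff)
  qed
  from this[of l m] this[of r s] show ?thesis using assms(2) by simp
qed

text \<open>The two transpositions may overlap, so this covers both \<open>cycle3\<close> and
  \<open>transpose2\<close>.\<close>

lemma transpose_comp_in_alt_group:
  assumes "{i, j, k, l} \<subseteq> {1..n}" "i \<noteq> j" "k \<noteq> l"
  shows "transpose i j \<circ> transpose k l \<in> carrier (alt_group n)"
  using assms
  by (auto simp: alt_group_carrier evenperm_comp evenperm_swap permutation_swap_id
      intro!: permutes_compose permutes_swap_id)

lemma alt_group_difference_graph_arc:
  assumes sub: "{i, j, k, l, m, r, s} \<subseteq> {1..n}" and dist: "distinct [i, j, k, l, m, r, s]"
  shows "(cycle3 i j k, transpose2 l m r s) \<in> parcs (difference_graph (alt_group n))"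
proof -
  interpret group "alt_group n" by (rule alt_group_is_group)
  let ?G = "alt_group n"
  define p where "p = cycle3 i j k"
  define q where "q = transpose2 l m r s"
  define c where "c = p \<circ> q"
  have p: "p \<in> carrier ?G" and q: "q \<in> carrier ?G"
    unfolding p_def q_def using sub dist by (auto intro!: transpose_comp_in_alt_group)
  have c: "c \<in> carrier ?G"
    using m_closed[OF p q] by (simp add: c_def alt_group_mult)
  have c_in: "c \<in> generate ?G {c}"
    by (simp add: generate.incl)
  have mult: "x \<circ> y \<in> generate ?G {c}" if "x \<in> generate ?G {c}" "y \<in> generate ?G {c}" for x y
    using generate.eng[OF that] by (simp add: alt_group_mult)
  have "distinct [i, j, k]" "distinct [l, m, r, s]" "{i, j, k} \<inter> {l, m, r, s} = {}"
    using dist by auto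
  note pq = cycle3_transpose2_commute[OF this, folded p_def q_def]
    and p3 = cycle3_cubed[OF this(1), folded p_def]
    and q2 = transpose2_involutory[OF this(2), folded q_def]
  \<comment> \<open>Since \<open>p\<close> and \<open>q\<close> commute and have orders dividing 3
    and 2, the fourth power of \<open>c\<close> leaves \<open>p\<close> and the third leaves
    \<open>q\<close>.\<close>
  have "c \<circ> c \<circ> c \<circ> c = p" "c \<circ> c \<circ> c = q"
    unfolding c_def by (simp_all add: fun_eq_iff pq p3 q2)
  then have "p \<in> generate ?G {c}" "q \<in> generate ?G {c}"
    using mult c_in by metis+
  \<comment> \<open>The point \<open>i\<close> is moved by \<open>p\<close> only and
    \<open>l\<close> by \<open>q\<close> only, so neither permutation is a power of the
    other.\<close>
  moreover have "p i \<noteq> i" "q i = i" "p l = l" "q l \<noteq> l"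
    unfolding p_def q_def using dist by (auto simp: transpose_def)
  then have "p \<noteq> q" "p \<notin> generate ?G {q}" "q \<notin> generate ?G {p}"
    using alt_group_generate_fixes p q by metis+
  ultimately show ?thesis
    using p q c
    unfolding p_def[symmetric] q_def[symmetric]
    by (auto simp: difference_graph_def remove_isolated_def graph_minus_def
        enhanced_power_graph_def power_graph_def)
qed

theorem corollary5p5:
  fixes n :: nat
  assumes "n \<ge> 7"
  shows "\<not> split_graph (difference_graph (alt_group n)) \<and>
         \<not> threshold_graph (difference_graph (alt_group n))"
proof -
  let ?D = "difference_graph (alt_group n)"
  have "finite (carrier (alt_group n))"
    by (rule finite_subset[OF _ finite_permutations[of "{1..n}"]])
      (auto simp: alt_group_carrier)
  then have D: "pair_graph ?D"
    by (rule pair_graph_difference_graph)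
  have non: "(p, q) \<notin> parcs ?D" if "p (q x) \<noteq> q (p x)" for p q x
    using group.difference_graph_arc_commute[OF alt_group_is_group, of p q n] that
    by (auto simp: alt_group_mult fun_eq_iff)
  \<comment> \<open>The second pair is the first with the labels 3 and 4 exchanged. Each pair
    occupies all of the points 1 to 7, whence the bound on \<open>n\<close>.\<close>
  let ?a = "cycle3 1 2 (3::nat)" and ?b = "transpose2 4 5 6 (7::nat)"
  let ?c = "cycle3 1 2 (4::nat)" and ?d = "transpose2 3 5 6 (7::nat)"
  have arcs: "(?a, ?b) \<in> parcs ?D" "(?c, ?d) \<in> parcs ?D"
    using assms by (auto intro!: alt_group_difference_graph_arc)
  have nonarcs: "(?a, ?c) \<notin> parcs ?D" "(?a, ?d) \<notin> parcs ?D"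
    "(?b, ?c) \<notin> parcs ?D" "(?b, ?d) \<notin> parcs ?D"
    \<comment> \<open>The last argument is a point at which the two products differ.\<close>
    using non[of ?a ?c 3] non[of ?a ?d 3] non[of ?b ?c 4] non[of ?b ?d 3]
    by (simp_all add: transpose_def)
  show ?thesis
    using has_induced_two_K2I[OF D arcs nonarcs] not_split_graphI[OF D arcs nonarcs]
    by (simp add: threshold_graph_def)
qed

end
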